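(* Each duo semigroup $X$ is an $E$-separated $E$-semigroup.
   Context: A semigroup $X$ is called duo if $xX=Xx$ for every $x\in X$, where $xX=\{xy:y\in X\}$ and $Xx=\{yx:y\in X\}$. Let $E(X)=\{x\in X:xx=x\}$ be the set of idempotents of $X$. A semigroup $X$ is an $E$-semigroup if $E(X)$ is a subsemigroup of $X$, i.e. closed under multiplication. A semilattice is a commutative semigroup all of whose elements are idempotents. A semigroup $X$ is $E$-separated if for any distinct $x,y\in E(X)$ there is a homomorphism $h:X\to Y$ to a semilattice $Y$ with $h(x)\ne h(y)$. *)

theory Defs
  imports Main
begin

text \<open>
  A semigroup is represented by its multiplication on a full type, through the
  locales \<^locale>\<open>semigroup\<close> and \<^locale>\<open>semilattice\<close> of HOL.
\<close>

locale duo_semigroup = semigroup f for f :: "'a \<Rightarrow> 'a \<Rightarrow> 'a" +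
  assumes duo: "{f x y |y. y \<in> UNIV} = {f y x |y. y \<in> UNIV}"

definition idempotents :: "('a \<Rightarrow> 'a \<Rightarrow> 'a) \<Rightarrow> 'a set" where
  "idempotents f = {x. f x x = x}"

locale E_semigroup = semigroup f for f :: "'a \<Rightarrow> 'a \<Rightarrow> 'a" +
  assumes idempotents_closed:
    "\<lbrakk>x \<in> idempotents f; y \<in> idempotents f\<rbrakk> \<Longrightarrow> f x y \<in> idempotents f"

definition semigroup_hom ::
    "('a \<Rightarrow> 'a \<Rightarrow> 'a) \<Rightarrow> ('b \<Rightarrow> 'b \<Rightarrow> 'b) \<Rightarrow> ('a \<Rightarrow> 'b) \<Rightarrow> bool" where
  "semigroup_hom f g h \<longleftrightarrow> (\<forall>x y. h (f x y) = g (h x) (h y))"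

text \<open>
  HOL cannot quantify existentially over the type underlying the target semilattice,
  so that type is fixed to be \<^typ>\<open>'a set\<close>. This is no restriction: by
  \<open>separating_semilattice_transfer\<close> below, a homomorphism separating two
  elements and taking values in a semilattice carried by any subset of any type can be
  replaced by one into a semilattice on \<^typ>\<open>'a set\<close>.
\<close>

locale E_separated = semigroup f for f :: "'a \<Rightarrow> 'a \<Rightarrow> 'a" +
  assumes separated:
    "\<lbrakk>x \<in> idempotents f; y \<in> idempotents f; x \<noteq> y\<rbrakk> \<Longrightarrow>
      \<exists>(g :: 'a set \<Rightarrow> 'a set \<Rightarrow> 'a set) h.
        semilattice g \<and> semigroup_hom f g h \<and> h x \<noteq> h y"

lemma separating_semilattice_transfer:
  fixes f :: "'a \<Rightarrow> 'a \<Rightarrow> 'a" and g :: "'b \<Rightarrow> 'b \<Rightarrow> 'b" and Y :: "'b set"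
  assumes closed: "\<And>a b. \<lbrakk>a \<in> Y; b \<in> Y\<rbrakk> \<Longrightarrow> g a b \<in> Y"
    and assoc: "\<And>a b c. \<lbrakk>a \<in> Y; b \<in> Y; c \<in> Y\<rbrakk> \<Longrightarrow> g (g a b) c = g a (g b c)"
    and comm: "\<And>a b. \<lbrakk>a \<in> Y; b \<in> Y\<rbrakk> \<Longrightarrow> g a b = g b a"
    and idem: "\<And>a. a \<in> Y \<Longrightarrow> g a a = a"
    and into: "\<And>z. h z \<in> Y"
    and hom: "semigroup_hom f g h"
    and neq: "h x \<noteq> h y"
  shows "\<exists>(g' :: 'a set \<Rightarrow> 'a set \<Rightarrow> 'a set) h'.
    semilattice g' \<and> semigroup_hom f g' h' \<and> h' x \<noteq> h' y"
proof -
  have main: "\<exists>h' :: 'a \<Rightarrow> 'a set. semigroup_hom f (\<inter>) h' \<and> h' p \<noteq> h' q"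
    if pq: "g (h p) (h q) \<noteq> h p" for p q
  proof (intro exI conjI)
    let ?h = "\<lambda>z. if g (h p) (h z) = h p then UNIV else {} :: 'a set"
    have "g (h p) (g (h a) (h b)) = h p \<longleftrightarrow> g (h p) (h a) = h p \<and> g (h p) (h b) = h p"
      for a b
      by (metis assoc comm idem closed into)
    then show "semigroup_hom f (\<inter>) ?h"
      using hom by (simp add: semigroup_hom_def)
    show "?h p \<noteq> ?h q"
      using pq idem[OF into] by simp
  qed
  have "g (h x) (h y) \<noteq> h x \<or> g (h y) (h x) \<noteq> h y"
    using comm[OF into into] neq by metis
  then obtain h' :: "'a \<Rightarrow> 'a set" where "semigroup_hom f (\<inter>) h'" "h' x \<noteq> h' y"
    using main by metis
  moreover have "semilattice ((\<inter>) :: 'a set \<Rightarrow> _)"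
    by unfold_locales
  ultimately show ?thesis
    by blast
qed

end

theory Submission
  imports Defs
begin

text \<open>
  In a duo semigroup every idempotent \<open>e\<close> is central: both \<open>e a\<close> and \<open>a e\<close> lie in
  \<open>e X = X e\<close>, where \<open>e\<close> acts as a two-sided identity, so that \<open>e a = e a e = a e\<close>.
  Hence idempotents commute and their products are idempotent.

  Send each \<open>x\<close> to the set of the idempotents in its principal ideal \<open>x X = X x\<close>.
  This turns products into intersections. An idempotent in \<open>(x y) X\<close> lies in \<open>x X\<close>, and
  in \<open>y X\<close> because the duo law moves \<open>y\<close> to the front of \<open>x y\<close>. Conversely, if
  \<open>e = x a = y b\<close>, then centrality of \<open>e\<close> gives \<open>e = x a e = x e a = x y b a\<close>. So one map
  into the power set, a semilattice under intersection, is a homomorphism. It separates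
  all pairs of idempotents at once: if \<open>d\<close> and \<open>e\<close> have the same image, each lies in the
  ideal generated by the other, so \<open>e = d e = e d = d\<close>.
\<close>

context duo_semigroup
begin

notation f (infixl "\<cdot>" 70)

lemma left_factor_to_right: "\<exists>c. a \<cdot> b = c \<cdot> a"
  using duo[of a] by blast

lemma right_factor_to_left: "\<exists>c. b \<cdot> a = a \<cdot> c"
  using duo[of a] by blast

text \<open>
  The products \<open>e a\<close> and \<open>a e\<close> can be written as \<open>c e\<close> and \<open>e d\<close>, so multiplying the
  former by \<open>e\<close> on the right, or the latter on the left, changes nothing;
  both products therefore equal \<open>e a e\<close>.
\<close>
lemma idempotent_central:
  assumes "e \<in> idempotents f"
  shows "e \<cdot> a = a \<cdot> e"
proof -
  have ee: "e \<cdot> e = e"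
    using assms by (simp add: idempotents_def)
  obtain c where c: "e \<cdot> a = c \<cdot> e"
    using left_factor_to_right by blast
  obtain d where d: "a \<cdot> e = e \<cdot> d"
    using right_factor_to_left by blast
  have "e \<cdot> a = e \<cdot> a \<cdot> e"
    by (simp add: c assoc ee)
  also have "\<dots> = e \<cdot> (e \<cdot> d)"
    by (simp add: assoc d)
  also have "\<dots> = a \<cdot> e"
    by (simp add: assoc[symmetric] ee d)
  finally show ?thesis .
qed

lemma idempotents_mult_closed:
  assumes "d \<in> idempotents f" "e \<in> idempotents f"
  shows "d \<cdot> e \<in> idempotents f"
proof -
  have "d \<cdot> e \<cdot> (d \<cdot> e) = d \<cdot> (e \<cdot> d) \<cdot> e"
    by (simp add: assoc)
  also have "\<dots> = d \<cdot> (d \<cdot> e) \<cdot> e"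
    using idempotent_central[OF assms(1)] by simp
  also have "\<dots> = d \<cdot> d \<cdot> (e \<cdot> e)"
    by (simp add: assoc)
  also have "\<dots> = d \<cdot> e"
    using assms by (simp add: idempotents_def)
  finally show ?thesis
    by (simp add: idempotents_def)
qed

definition idempotent_multiples :: "'a \<Rightarrow> 'a set" where
  "idempotent_multiples x = {e \<in> idempotents f. \<exists>a. e = x \<cdot> a}"

lemma idempotent_multiples_mult:
  "idempotent_multiples (x \<cdot> y) = idempotent_multiples x \<inter> idempotent_multiples y"
proof (intro equalityI subsetI)
  fix e assume "e \<in> idempotent_multiples (x \<cdot> y)"
  then obtain a where e: "e \<in> idempotents f" "e = x \<cdot> y \<cdot> a"
    by (auto simp: idempotent_multiples_def)
  obtain c where c: "x \<cdot> y = y \<cdot> c"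
    using right_factor_to_left by blast
  have "e = x \<cdot> (y \<cdot> a)"
    using e(2) by (simp add: assoc)
  moreover have "e = y \<cdot> (c \<cdot> a)"
    unfolding e(2) c by (rule assoc)
  ultimately show "e \<in> idempotent_multiples x \<inter> idempotent_multiples y"
    using e(1) unfolding idempotent_multiples_def by blast
next
  fix e assume "e \<in> idempotent_multiples x \<inter> idempotent_multiples y"
  then obtain a b where e: "e \<in> idempotents f" and a: "e = x \<cdot> a" and b: "e = y \<cdot> b"
    unfolding idempotent_multiples_def by blast
  have "e = x \<cdot> a \<cdot> e"
    using e a by (simp add: idempotents_def)
  also have "\<dots> = x \<cdot> (e \<cdot> a)"
    by (simp add: assoc idempotent_central[OF e])
  also have "\<dots> = x \<cdot> y \<cdot> (b \<cdot> a)"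
    by (simp add: b assoc)
  finally show "e \<in> idempotent_multiples (x \<cdot> y)"
    using e by (auto simp: idempotent_multiples_def)
qed

lemma idempotent_multiples_hom: "semigroup_hom f (\<inter>) idempotent_multiples"
  by (simp add: semigroup_hom_def idempotent_multiples_mult)

text \<open>
  An idempotent \<open>d\<close> is a left identity on \<open>d X\<close>, so for idempotents \<open>e \<in> d X\<close> means
  \<open>e = d e\<close>. Together with commutativity this is the natural partial order on
  idempotents, and injectivity is its antisymmetry.
\<close>
lemma inj_on_idempotent_multiples: "inj_on idempotent_multiples (idempotents f)"
proof (rule inj_onI)
  fix d e
  assume d: "d \<in> idempotents f" and e: "e \<in> idempotents f"
    and eq: "idempotent_multiples d = idempotent_multiples e"
  have self: "z \<in> idempotent_multiples z" if "z \<in> idempotents f" for z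
    using that unfolding idempotent_multiples_def idempotents_def by (auto intro: sym)
  have absorb: "u \<cdot> v = v" if "u \<in> idempotents f" "v \<in> idempotent_multiples u" for u v
    using that by (auto simp: idempotent_multiples_def idempotents_def assoc[symmetric])
  have "e = d \<cdot> e"
    using absorb[OF d] self[OF e] eq by simp
  also have "\<dots> = e \<cdot> d"
    using idempotent_central[OF d] .
  also have "\<dots> = d"
    using absorb[OF e] self[OF d] eq by simp
  finally show "d = e" ..
qed

end

theorem proposition4p1:
  fixes f :: "'a \<Rightarrow> 'a \<Rightarrow> 'a"
  assumes "duo_semigroup f"
  shows "E_separated f \<and> E_semigroup f"
proof -
  interpret duo_semigroup f
    by fact
  have "semilattice ((\<inter>) :: 'a set \<Rightarrow> _)"
    by unfold_locales
  then have "E_separated f"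
    using idempotent_multiples_hom inj_onD[OF inj_on_idempotent_multiples]
    by unfold_locales blast
  moreover have "E_semigroup f"
    by unfold_locales (rule idempotents_mult_closed)
  ultimately show ?thesis ..
qed

end
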